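(* Let $k\ge 3$ and let $G$ be a connected $n$-vertex graph with a $(k,1)$-cover, where $n-k=q(k-1)+r$ with integers $q\ge 0$ and $1\le r\le k-1$. Then the number of edges of $G$ is at least $(q+2)\binom{k}{2}-\binom{k-r}{2}$. Moreover, equality holds if and only if $G\in\mathcal{G}_{tree}(qK_k,L)$, where $L$ is the graph formed by the union of two copies of $K_k$ sharing exactly $k-r$ vertices.
   Context: A graph $G$ has a $(k,\ell)$-cover if every edge of $G$ lies in at least $\ell$ copies of $K_k$ (subgraphs isomorphic to the complete graph on $k$ vertices). A hypergraph is linear if any two distinct hyperedges share at most one vertex. In a hypergraph, a cycle of length $\ell\ge 2$ is a set of $\ell$ hyperedges labelled $e_1,\dots,e_\ell$ for which there exist distinct vertices $v_1,\dots,v_\ell$ with $v_i\in e_i\cap e_{i+1}$ for all $i\in[\ell]$ (where $e_{\ell+1}=e_1$); a hypertree is a connected hypergraph with no cycle. For graphs $F_1,\dots,F_m$, $\mathcal{G}_{tree}(F_1,\dots,F_m)$ is the family of graphs $G$ for which there is a linear hypertree with vertex set $V(G)$ and $m$ hyperedges $E_1,\dots,E_m\subseteq V(G)$ such that (1) for every edge $uv\in E(G)$ there is $i\in[m]$ with $u,v\in E_i$, and (2) for every $i\in[m]$ the induced subgraph $G[E_i]$ is isomorphic to $F_i$. The notation $\mathcal{G}_{tree}(qK_k,L)$ means $\mathcal{G}_{tree}(F_1,\dots,F_{q+1})$ with $F_1=\dots=F_q=K_k$ and $F_{q+1}=L$. *)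

theory Defs
  imports "HOL-Library.Ramsey"
begin

text \<open>
  A hypergraph is a pair of a vertex set and a set of hyperedges; a simple graph is a hypergraph
  all of whose hyperedges have two elements. All hypergraphs are finite. The library notation
  \<open>[A]\<^bsup>k\<^esup>\<close> stands for the set of \<open>k\<close>-element subsets of \<open>A\<close>.
\<close>

type_synonym 'a hypergraph = "'a set \<times> 'a set set"
type_synonym 'a graph = "'a hypergraph"

abbreviation verts :: "'a hypergraph \<Rightarrow> 'a set" where "verts \<equiv> fst"
abbreviation edges :: "'a hypergraph \<Rightarrow> 'a set set" where "edges \<equiv> snd"

definition hypergraph :: "'a hypergraph \<Rightarrow> bool" where
  "hypergraph H \<longleftrightarrow> finite (verts H) \<and> (\<forall>e\<in>edges H. e \<noteq> {} \<and> e \<subseteq> verts H)"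

definition simple_graph :: "'a graph \<Rightarrow> bool" where
  "simple_graph G \<longleftrightarrow> finite (verts G) \<and> edges G \<subseteq> [verts G]\<^bsup>2\<^esup>"

definition connected_hypergraph :: "'a hypergraph \<Rightarrow> bool" where
  "connected_hypergraph H \<longleftrightarrow> verts H \<noteq> {} \<and>
     (\<forall>u\<in>verts H. \<forall>v\<in>verts H. (u, v) \<in> {(x, y). \<exists>e\<in>edges H. x \<in> e \<and> y \<in> e}\<^sup>*)"

definition graph_iso :: "'a graph \<Rightarrow> 'b graph \<Rightarrow> bool" (infix "\<simeq>\<^sub>g" 50) where
  "G \<simeq>\<^sub>g H \<longleftrightarrow> (\<exists>f. bij_betw f (verts G) (verts H) \<and> edges H = (\<lambda>e. f ` e) ` edges G)"

definition subgraph :: "'a graph \<Rightarrow> 'a graph \<Rightarrow> bool" where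
  "subgraph H G \<longleftrightarrow> simple_graph H \<and> verts H \<subseteq> verts G \<and> edges H \<subseteq> edges G"

definition induced_subgraph :: "'a graph \<Rightarrow> 'a set \<Rightarrow> 'a graph" where
  "induced_subgraph G S = (S, {e \<in> edges G. e \<subseteq> S})"

definition graph_union :: "'a graph \<Rightarrow> 'a graph \<Rightarrow> 'a graph" where
  "graph_union G H = (verts G \<union> verts H, edges G \<union> edges H)"

definition complete_on :: "'a set \<Rightarrow> 'a graph" where
  "complete_on S = (S, [S]\<^bsup>2\<^esup>)"

abbreviation K :: "nat \<Rightarrow> nat graph" where
  "K k \<equiv> complete_on {..<k}"

text \<open>
  Two copies of \<open>K k\<close> on the vertex sets \<open>{0, \<dots>, k - 1}\<close> and \<open>{k - s, \<dots>, 2 k - s - 1}\<close>. For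
  \<open>s \<le> k\<close> these are \<open>k\<close>-element sets sharing exactly \<open>s\<close> vertices.
\<close>

definition two_cliques :: "nat \<Rightarrow> nat \<Rightarrow> nat graph" where
  "two_cliques k s = graph_union (complete_on {0..<k}) (complete_on {k - s..<2 * k - s})"

definition copies :: "'b graph \<Rightarrow> 'a graph \<Rightarrow> 'a graph set" where
  "copies F G = {H. subgraph H G \<and> H \<simeq>\<^sub>g F}"

definition has_cover :: "nat \<Rightarrow> nat \<Rightarrow> 'a graph \<Rightarrow> bool" where
  "has_cover k l G \<longleftrightarrow> (\<forall>e\<in>edges G. l \<le> card {H \<in> copies (K k) G. e \<in> edges H})"

definition linear_hypergraph :: "'a hypergraph \<Rightarrow> bool" where
  "linear_hypergraph H \<longleftrightarrow> (\<forall>e\<in>edges H. \<forall>f\<in>edges H. e \<noteq> f \<longrightarrow> card (e \<inter> f) \<le> 1)"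

definition has_cycle :: "'a hypergraph \<Rightarrow> bool" where
  "has_cycle H \<longleftrightarrow> (\<exists>l e v. 2 \<le> l \<and>
     inj_on e {..<l} \<and> e ` {..<l} \<subseteq> edges H \<and> inj_on v {..<l} \<and>
     (\<forall>i<l. v i \<in> e i \<inter> e (Suc i mod l)))"

definition hypertree :: "'a hypergraph \<Rightarrow> bool" where
  "hypertree H \<longleftrightarrow> hypergraph H \<and> connected_hypergraph H \<and> \<not> has_cycle H"

text \<open>
  The hyperedges are indexed from 0; injectivity of the indexing says that the hypertree has
  exactly as many hyperedges as the list has graphs.
\<close>

definition G_tree :: "'b graph list \<Rightarrow> 'a graph set" where
  "G_tree Fs = {G. simple_graph G \<and>
     (\<exists>E. inj_on E {..<length Fs} \<and>
        linear_hypergraph (verts G, E ` {..<length Fs}) \<and>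
        hypertree (verts G, E ` {..<length Fs}) \<and>
        (\<forall>u v. {u, v} \<in> edges G \<longrightarrow> (\<exists>i<length Fs. u \<in> E i \<and> v \<in> E i)) \<and>
        (\<forall>i<length Fs. induced_subgraph G (E i) \<simeq>\<^sub>g Fs ! i))}"

end

theory Submission
  imports Defs
begin

text \<open>
  Grow \<open>G\<close> from a single \<open>k\<close>-clique by repeatedly attaching a \<open>k\<close>-clique that meets the current
  vertex set. A clique with \<open>t\<close> new vertices brings at least
  \<open>g(t) = (k choose 2) - (k - t choose 2) = t (2 k - 1 - t) / 2\<close> new edges, and \<open>g\<close> is strictly
  concave with \<open>g(0) = 0\<close>. Hence the cheapest way of gaining \<open>q (k - 1) + r\<close> vertices is to use \<open>q\<close>
  steps with \<open>t = k - 1\<close> and one with \<open>t = r\<close>. In the equality case the old part of every attached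
  clique is already a clique, hence lies in a single hyperedge of the hypertree built so far.
\<close>

subsection \<open>Cycles in hypergraphs\<close>

text \<open>A hyperedge on a cycle contains the cycle vertices just before and just after it; they
  are distinct, and each also lies in a neighbouring hyperedge. If \<open>e\<close> meets
  \<open>\<Union>A\<close> in at most one vertex, every cycle therefore stays inside
  \<open>A\<close>.\<close>

lemma has_cycle_insertD:
  assumes "has_cycle (V, insert e A)"
    and meet: "\<And>x y. x \<in> e \<inter> \<Union>A \<Longrightarrow> y \<in> e \<inter> \<Union>A \<Longrightarrow> x = y"
  shows "has_cycle (W, A)"
proof -
  obtain l E v where l: "2 \<le> l" and E: "inj_on E {..<l}" "E ` {..<l} \<subseteq> insert e A"
    and v: "inj_on v {..<l}" and vE: "\<And>i. i < l \<Longrightarrow> v i \<in> E i \<inter> E (Suc i mod l)"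
    using assms(1) unfolding has_cycle_def by auto
  have "e \<notin> E ` {..<l}"
  proof
    assume "e \<in> E ` {..<l}"
    then obtain i where i: "i < l" "E i = e" by auto
    \<comment> \<open>\<open>j\<close> is the cyclic predecessor of \<open>i\<close>; it differs
      from \<open>i\<close> because \<open>2 \<le> l\<close>, so \<open>v i\<close> and
      \<open>v j\<close> are two vertices.\<close>
    define j where "j = (if i = 0 then l - 1 else i - 1)"
    have j: "j < l" "Suc j mod l = i" "j \<noteq> i"
      using i l by (auto simp: j_def)
    have s: "Suc i mod l < l" "Suc i mod l \<noteq> i"
      using i l by (auto simp: mod_Suc)
    have "E j \<noteq> e" "E (Suc i mod l) \<noteq> e"
      using E(1) i j s by (auto simp: inj_on_def)
    hence "E j \<in> A" "E (Suc i mod l) \<in> A"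
      using E(2) j(1) s(1) by (meson image_subset_iff insertE lessThan_iff)+
    hence "v j \<in> e \<inter> \<Union>A" "v i \<in> e \<inter> \<Union>A"
      using vE[OF j(1)] vE[OF i(1)] i(2) j(2) by auto
    hence "v i = v j" using meet by blast
    thus False using v i(1) j by (auto simp: inj_on_def)
  qed
  hence "E ` {..<l} \<subseteq> A" using E(2) by auto
  thus ?thesis
    unfolding has_cycle_def using l E(1) v vE
    by (intro exI[of _ l] exI[of _ E] exI[of _ v]) simp
qed

text \<open>Each cycle vertex lies in two different hyperedges, hence in some member of
  \<open>A\<close>, hence outside \<open>C - B\<close>. So a cycle through
  \<open>B \<union> C\<close> survives when \<open>B \<union> C\<close> shrinks to
  \<open>B\<close>.\<close>

lemma has_cycle_extendD:
  assumes "has_cycle (V, insert (B \<union> C) A)"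
    and B: "B \<notin> A" and C: "(C - B) \<inter> \<Union>A = {}"
  shows "has_cycle (W, insert B A)"
proof -
  obtain l E v where l: "2 \<le> l" and E: "inj_on E {..<l}" "E ` {..<l} \<subseteq> insert (B \<union> C) A"
    and v: "inj_on v {..<l}" and vE: "\<And>i. i < l \<Longrightarrow> v i \<in> E i \<inter> E (Suc i mod l)"
    using assms(1) unfolding has_cycle_def by auto
  define E' where "E' i = (if E i = B \<union> C then B else E i)" for i
  have in_A: "E i \<in> A" if "i < l" "E i \<noteq> B \<union> C" for i
    using E(2) that by auto
  \<comment> \<open>As \<open>B \<notin> A\<close>, the shrunken hyperedge cannot coincide with
    another one on the cycle.\<close>
  have "inj_on E' {..<l}"
  proof (rule inj_onI)
    fix i j assume *: "i \<in> {..<l}" "j \<in> {..<l}" "E' i = E' j"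
    hence "E i = E j"
      using in_A[of i] in_A[of j] B by (auto simp: E'_def split: if_splits)
    thus "i = j" using E(1) * by (auto simp: inj_on_def)
  qed
  moreover have "E' ` {..<l} \<subseteq> insert B A"
    using in_A by (auto simp: E'_def)
  moreover have "v i \<in> E' i \<inter> E' (Suc i mod l)" if i: "i < l" for i
  proof -
    have s: "Suc i mod l < l" "Suc i mod l \<noteq> i"
      using i l by (auto simp: mod_Suc)
    hence ne: "E (Suc i mod l) \<noteq> E i"
      using E(1) i by (auto simp: inj_on_def)
    have "v i \<in> \<Union>A"
      using ne in_A[OF i] in_A[OF s(1)] vE[OF i] by (cases "E i = B \<union> C") auto
    thus ?thesis using vE[OF i] C by (auto simp: E'_def)
  qed
  ultimately show ?thesis
    unfolding has_cycle_def using l v by auto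
qed

text \<open>Otherwise the two hyperedges would form a cycle of length 2.\<close>

lemma acyclic_share_two_eq:
  assumes "\<not> has_cycle (V, A)" "X \<in> A" "Y \<in> A" "x \<noteq> y" "{x, y} \<subseteq> X" "{x, y} \<subseteq> Y"
  shows "X = Y"
proof (rule ccontr)
  assume "X \<noteq> Y"
  have "has_cycle (V, A)"
    unfolding has_cycle_def
    using assms \<open>X \<noteq> Y\<close>
    by (intro exI[of _ 2] exI[of _ "\<lambda>i. if i = 0 then X else Y"] exI[of _ "\<lambda>i. if i = 0 then x else y"])
       (auto simp: inj_on_def)
  thus False using assms(1) by contradiction
qed

lemma acyclic_linear:
  assumes "\<not> has_cycle (V, A)"
  shows "linear_hypergraph (V, A)"
  unfolding linear_hypergraph_def
proof (intro ballI impI)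
  fix e f assume ef: "e \<in> edges (V, A)" "f \<in> edges (V, A)" "e \<noteq> f"
  show "card (e \<inter> f) \<le> 1"
  proof (rule ccontr)
    assume "\<not> card (e \<inter> f) \<le> 1"
    hence "1 < card (e \<inter> f)" by simp
    then obtain x y where "x \<in> e \<inter> f" "y \<in> e \<inter> f" "x \<noteq> y"
      by (metis One_nat_def card_gt_0_iff card_le_Suc0_iff_eq not_less order.strict_trans zero_less_one)
    thus False using acyclic_share_two_eq[OF assms, of e f x y] ef by auto
  qed
qed

text \<open>If \<open>z\<close> were outside \<open>X\<close>, the three hyperedges would be
  distinct and form a cycle of length 3 through \<open>y\<close>, \<open>z\<close>,
  \<open>x\<close>.\<close>

lemma acyclic_triangle:
  assumes ac: "\<not> has_cycle (V, A)" and "X \<in> A" "Y \<in> A" "Z \<in> A"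
    and "x \<noteq> y" "x \<noteq> z" "y \<noteq> z"
    and "{x, y} \<subseteq> X" "{y, z} \<subseteq> Y" "{x, z} \<subseteq> Z"
  shows "z \<in> X"
proof (rule ccontr)
  assume z: "z \<notin> X"
  hence "X \<noteq> Y" "X \<noteq> Z" using assms by auto
  \<comment> \<open>Were \<open>Y = Z\<close>, then \<open>X\<close> and \<open>Y\<close> would
    share \<open>x\<close> and \<open>y\<close>, forcing \<open>X = Y\<close>.\<close>
  moreover have "Y \<noteq> Z"
    using acyclic_share_two_eq[OF ac, of X Y x y] assms calculation by auto
  moreover define E where "E i = (if i = 0 then X else if i = 1 then Y else Z)" for i :: nat
  moreover define v where "v i = (if i = 0 then y else if i = 1 then z else x)" for i :: nat
  ultimately have inj: "inj_on E {0, 1, 2}" "inj_on v {0, 1, 2}"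
    using assms(5-7) by simp_all
  have three: "{..<3} = {0, 1, 2::nat}" by auto
  have "v i \<in> E i \<inter> E (Suc i mod 3)" if "i < 3" for i
  proof -
    from that have "i = 0 \<or> i = 1 \<or> i = 2" by linarith
    thus ?thesis using assms(8-10) by (elim disjE) (simp_all add: E_def v_def)
  qed
  moreover have "E ` {0, 1, 2} \<subseteq> A" using assms(2-4) by (simp add: E_def)
  ultimately have "has_cycle (V, A)"
    unfolding has_cycle_def snd_conv using inj
    by (intro exI[of _ 3] exI[of _ E] exI[of _ v]) (simp add: three)
  thus False using ac by contradiction
qed

text \<open>A Helly property: fix two vertices of \<open>X\<close> and a hyperedge \<open>B\<close>
  through them; any third vertex closes a triangle, so \<open>acyclic_triangle\<close> puts it into
  \<open>B\<close>. A single vertex has no pairs and is handled by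
  \<open>X \<subseteq> \<Union>A\<close>.\<close>

lemma acyclic_clique_in_hyperedge:
  assumes ac: "\<not> has_cycle (V, A)" and X: "X \<noteq> {}" "X \<subseteq> \<Union>A"
    and pairs: "[X]\<^bsup>2\<^esup> \<subseteq> (\<Union>B\<in>A. [B]\<^bsup>2\<^esup>)"
  obtains B where "B \<in> A" "X \<subseteq> B"
proof -
  have pair: "\<exists>B\<in>A. {a, b} \<subseteq> B" if "a \<in> X" "b \<in> X" "a \<noteq> b" for a b
  proof -
    have "{a, b} \<in> [X]\<^bsup>2\<^esup>" using that by (auto simp: nsets_def)
    hence "{a, b} \<in> (\<Union>B\<in>A. [B]\<^bsup>2\<^esup>)" using pairs by blast
    thus ?thesis by (auto simp: nsets_def)
  qed
  obtain x where x: "x \<in> X" using X by auto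
  show thesis
  proof (cases "X = {x}")
    case True
    thus thesis using X that by auto
  next
    case False
    then obtain y where y: "y \<in> X" "x \<noteq> y" using x by auto
    obtain B where B: "B \<in> A" "{x, y} \<subseteq> B" using pair[OF x y(1) y(2)] by auto
    have "z \<in> B" if z: "z \<in> X" for z
    proof (cases "z = x \<or> z = y")
      case False
      obtain Y Z where "Y \<in> A" "{y, z} \<subseteq> Y" "Z \<in> A" "{x, z} \<subseteq> Z"
        using pair[OF y(1) z] pair[OF x z] False by blast
      thus ?thesis using acyclic_triangle[OF ac B(1), of Y Z x y z] B False y by auto
    qed (use B in auto)
    thus thesis using B that by blast
  qed
qed

subsection \<open>Two-element subsets and isomorphisms\<close>

lemma nsets_inter: "[A]\<^bsup>n\<^esup> \<inter> [B]\<^bsup>n\<^esup> = [A \<inter> B]\<^bsup>n\<^esup>"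
  by (auto simp: nsets_def)

lemma image_nsets:
  assumes "inj_on f A"
  shows "(\<lambda>e. f ` e) ` [A]\<^bsup>n\<^esup> = [f ` A]\<^bsup>n\<^esup>"
proof
  show "(\<lambda>e. f ` e) ` [A]\<^bsup>n\<^esup> \<subseteq> [f ` A]\<^bsup>n\<^esup>"
    using assms by (auto simp: nsets_def card_image inj_on_subset)
  show "[f ` A]\<^bsup>n\<^esup> \<subseteq> (\<lambda>e. f ` e) ` [A]\<^bsup>n\<^esup>"
  proof
    fix y assume "y \<in> [f ` A]\<^bsup>n\<^esup>"
    hence y: "y \<subseteq> f ` A" "finite y" "card y = n" by (auto simp: nsets_def)
    then obtain x where x: "x \<subseteq> A" "y = f ` x" by (auto simp: subset_image_iff)
    have i: "inj_on f x" using assms x inj_on_subset by blast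
    have "x \<in> [A]\<^bsup>n\<^esup>"
      using x y i by (auto simp: nsets_def card_image finite_image_iff)
    thus "y \<in> (\<lambda>e. f ` e) ` [A]\<^bsup>n\<^esup>" using x by auto
  qed
qed

lemma two_times_choose_two: "2 * (n choose 2) = n * (n - 1)"
proof -
  have "even (n * (n - 1))" by (cases n) auto
  thus ?thesis unfolding choose_two by (rule dvd_mult_div_cancel)
qed

text \<open>Inclusion-exclusion: the common edges are the pairs inside the common interval of
  \<open>s\<close> vertices. The sum form avoids truncated subtraction.\<close>

lemma two_cliques_card_edges:
  assumes "s \<le> k"
  shows "card (edges (two_cliques k s)) + (s choose 2) = 2 * (k choose 2)"
proof -
  have i: "{0..<k} \<inter> {k - s..<2 * k - s} = {k - s..<k}" using assms by auto
  have "card ([{0..<k}]\<^bsup>2\<^esup> \<union> [{k - s..<2 * k - s}]\<^bsup>2\<^esup>) + card ([{0..<k}]\<^bsup>2\<^esup> \<inter> [{k - s..<2 * k - s}]\<^bsup>2\<^esup>)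
      = card ([{0..<k}]\<^bsup>2\<^esup>) + card ([{k - s..<2 * k - s}]\<^bsup>2\<^esup>)"
    by (rule card_Un_Int[symmetric]) (auto simp: finite_imp_finite_nsets)
  thus ?thesis
    using assms unfolding nsets_inter i
    by (simp add: two_cliques_def graph_union_def complete_on_def)
qed

lemma graph_iso_card_edges:
  assumes "G \<simeq>\<^sub>g H" and "edges G \<subseteq> Pow (verts G)"
  shows "card (edges G) = card (edges H)"
proof -
  obtain f where f: "bij_betw f (verts G) (verts H)" "edges H = (\<lambda>e. f ` e) ` edges G"
    using assms(1) unfolding graph_iso_def by auto
  have "inj_on (\<lambda>e. f ` e) (edges G)"
    using inj_on_image_Pow[of f "verts G"] f(1) assms(2)
    by (auto simp: bij_betw_def intro: inj_on_subset)
  thus ?thesis using f(2) by (simp add: card_image)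
qed

lemma complete_on_iso_K:
  assumes "finite B" "card B = k"
  shows "complete_on B \<simeq>\<^sub>g K k"
proof -
  obtain f where f: "bij_betw f B {..<k}"
    using assms ex_bij_betw_finite_nat[of B] by (auto simp: atLeast0LessThan)
  thus ?thesis
    unfolding graph_iso_def complete_on_def
    using image_nsets[of f B 2] by (auto simp: bij_betw_def)
qed

lemma union_iso_two_cliques:
  assumes "finite B" "finite C" "card B = k" "card C = k" "card (B \<inter> C) = s"
  shows "graph_union (complete_on B) (complete_on C) \<simeq>\<^sub>g two_cliques k s"
proof -
  have s: "s \<le> k" using card_mono[of B "B \<inter> C"] assms by auto
  have cBC: "card (B - C) = k - s"
    using assms card_Diff_subset_Int[of B C] by simp
  have cCB: "card (C - B) = k - s"
    using assms card_Diff_subset_Int[of C B] by (simp add: Int_commute)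
  \<comment> \<open>The blocks \<open>B - C\<close>, \<open>B \<inter> C\<close> and
    \<open>C - B\<close> are mapped to three consecutive intervals, so that the first two make up
    the first clique and the last two the second.\<close>
  obtain f1 where f1: "bij_betw f1 (B - C) {0..<k - s}"
    using finite_same_card_bij[of "B - C" "{0..<k - s}"] assms cBC by auto
  obtain f2 where f2: "bij_betw f2 (B \<inter> C) {k - s..<k}"
    using finite_same_card_bij[of "B \<inter> C" "{k - s..<k}"] assms s by auto
  obtain f3 where f3: "bij_betw f3 (C - B) {k..<2 * k - s}"
    using finite_same_card_bij[of "C - B" "{k..<2 * k - s}"] assms cCB by auto
  define f where "f x = (if x \<in> B - C then f1 x else if x \<in> B \<inter> C then f2 x else f3 x)" for x
  have g1: "bij_betw f (B - C) {0..<k - s}"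
    using f1 by (subst bij_betw_cong[of _ _ f1]) (auto simp: f_def)
  have g2: "bij_betw f (B \<inter> C) {k - s..<k}"
    using f2 by (subst bij_betw_cong[of _ _ f2]) (auto simp: f_def)
  have g3: "bij_betw f (C - B) {k..<2 * k - s}"
    using f3 by (subst bij_betw_cong[of _ _ f3]) (auto simp: f_def)
  have gB: "bij_betw f B {0..<k}"
  proof -
    have "bij_betw f ((B - C) \<union> (B \<inter> C)) ({0..<k - s} \<union> {k - s..<k})"
      by (rule bij_betw_combine[OF g1 g2]) auto
    moreover have "(B - C) \<union> (B \<inter> C) = B" by auto
    moreover have "{0..<k - s} \<union> {k - s..<k} = {0..<k}" by auto
    ultimately show ?thesis by simp
  qed
  have gC: "f ` C = {k - s..<2 * k - s}"
  proof -
    have "C = (B \<inter> C) \<union> (C - B)" by auto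
    hence "f ` C = f ` (B \<inter> C) \<union> f ` (C - B)" by (metis image_Un)
    also have "\<dots> = {k - s..<k} \<union> {k..<2 * k - s}"
      using g2 g3 by (simp add: bij_betw_def)
    also have "\<dots> = {k - s..<2 * k - s}" using s by auto
    finally show ?thesis .
  qed
  have gBC: "bij_betw f (B \<union> C) ({0..<k} \<union> {k - s..<2 * k - s})"
  proof -
    have "bij_betw f (B \<union> (C - B)) ({0..<k} \<union> {k..<2 * k - s})"
      by (rule bij_betw_combine[OF gB g3]) auto
    moreover have "{0..<k} \<union> {k..<2 * k - s} = {0..<k} \<union> {k - s..<2 * k - s}"
      using s by auto
    ultimately show ?thesis by simp
  qed
  have "inj_on f B" "inj_on f C"
    using gBC by (auto simp: bij_betw_def intro: inj_on_subset)
  moreover have "f ` B = {0..<k}" using gB by (simp add: bij_betw_def)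
  ultimately have "(\<lambda>e. f ` e) ` ([B]\<^bsup>2\<^esup> \<union> [C]\<^bsup>2\<^esup>) = [{0..<k}]\<^bsup>2\<^esup> \<union> [{k - s..<2 * k - s}]\<^bsup>2\<^esup>"
    using gC by (simp add: image_Un image_nsets)
  thus ?thesis
    unfolding graph_iso_def two_cliques_def graph_union_def complete_on_def
    using gBC by auto
qed

subsection \<open>Trees of cliques\<close>

text \<open>Connectedness is not recorded here; it is taken from \<open>G\<close> once the
  construction spans \<open>G\<close>.\<close>

definition clique_tree :: "nat \<Rightarrow> nat \<Rightarrow> 'a graph \<Rightarrow> bool" where
  "clique_tree k q H \<longleftrightarrow> (\<exists>A. finite A \<and> card A = q \<and> (\<forall>B\<in>A. finite B \<and> card B = k) \<and>
     \<Union>A = verts H \<and> edges H = (\<Union>B\<in>A. [B]\<^bsup>2\<^esup>) \<and> \<not> has_cycle (verts H, A))"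

text \<open>The union \<open>B \<union> C\<close> is the one hyperedge that carries the graph
  \<open>L\<close>; the \<open>q\<close> members of \<open>A\<close> carry the copies of
  \<open>K k\<close>.\<close>

definition doubled_clique_tree :: "nat \<Rightarrow> nat \<Rightarrow> nat \<Rightarrow> 'a graph \<Rightarrow> bool" where
  "doubled_clique_tree k q s H \<longleftrightarrow> (\<exists>A B C. finite A \<and> card A = q \<and>
     (\<forall>X\<in>A. finite X \<and> card X = k) \<and>
     finite B \<and> finite C \<and> card B = k \<and> card C = k \<and> card (B \<inter> C) = s \<and> B \<union> C \<notin> A \<and>
     \<Union>A \<union> B \<union> C = verts H \<and> edges H = (\<Union>X\<in>A. [X]\<^bsup>2\<^esup>) \<union> [B]\<^bsup>2\<^esup> \<union> [C]\<^bsup>2\<^esup> \<and>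
     \<not> has_cycle (verts H, insert (B \<union> C) A))"

lemma clique_tree_single:
  assumes "finite C" "card C = k"
  shows "clique_tree k 1 (complete_on C)"
proof -
  have "\<not> has_cycle (C, {})"
    by (auto simp: has_cycle_def lessThan_empty_iff)
  hence "\<not> has_cycle (C, {C})"
    using has_cycle_insertD[of C C "{}" C] by auto
  thus ?thesis
    unfolding clique_tree_def complete_on_def using assms by (intro exI[of _ "{C}"]) auto
qed

lemma card_one_eq: "card X = 1 \<Longrightarrow> x \<in> X \<Longrightarrow> y \<in> X \<Longrightarrow> x = y"
  by (auto simp: card_1_singleton_iff)

text \<open>Meeting the old vertices only once makes \<open>C\<close> a leaf hyperedge, which lies
  on no cycle by \<open>has_cycle_insertD\<close>.\<close>

lemma clique_tree_attach_leaf: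
  assumes "clique_tree k q H" "finite C" "card C = k" "\<not> C \<subseteq> verts H" "card (C \<inter> verts H) = 1"
  shows "clique_tree k (Suc q) (graph_union H (complete_on C))"
proof -
  obtain A where A: "finite A" "card A = q" "\<forall>B\<in>A. finite B \<and> card B = k"
    "\<Union>A = verts H" "edges H = (\<Union>B\<in>A. [B]\<^bsup>2\<^esup>)" "\<not> has_cycle (verts H, A)"
    using assms(1) unfolding clique_tree_def by auto
  have "C \<notin> A" using A(4) assms(4) by auto
  moreover have "\<not> has_cycle (verts H \<union> C, insert C A)"
  proof
    assume "has_cycle (verts H \<union> C, insert C A)"
    hence "has_cycle (verts H, A)"
      by (rule has_cycle_insertD) (unfold A(4), rule card_one_eq[OF assms(5)])
    thus False using A by simp
  qed
  ultimately show ?thesis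
    unfolding clique_tree_def graph_union_def complete_on_def
    using A assms by (intro exI[of _ "insert C A"]) auto
qed

lemma doubled_clique_tree_attach_leaf:
  assumes "doubled_clique_tree k q s H" "finite C" "card C = k" "\<not> C \<subseteq> verts H"
    "card (C \<inter> verts H) = 1"
  shows "doubled_clique_tree k (Suc q) s (graph_union H (complete_on C))"
proof -
  obtain A B D where A: "finite A" "card A = q" "\<forall>X\<in>A. finite X \<and> card X = k"
    "finite B" "finite D" "card B = k" "card D = k" "card (B \<inter> D) = s" "B \<union> D \<notin> A"
    "\<Union>A \<union> B \<union> D = verts H" "edges H = (\<Union>X\<in>A. [X]\<^bsup>2\<^esup>) \<union> [B]\<^bsup>2\<^esup> \<union> [D]\<^bsup>2\<^esup>"
    "\<not> has_cycle (verts H, insert (B \<union> D) A)"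
    using assms(1) unfolding doubled_clique_tree_def by auto
  have U: "\<Union>(insert (B \<union> D) A) = verts H" using A(10) by auto
  have C: "C \<notin> A" "B \<union> D \<noteq> C" using A(10) assms(4) by auto
  have "\<not> has_cycle (verts H \<union> C, insert C (insert (B \<union> D) A))"
  proof
    assume "has_cycle (verts H \<union> C, insert C (insert (B \<union> D) A))"
    hence "has_cycle (verts H, insert (B \<union> D) A)"
      by (rule has_cycle_insertD) (unfold U, rule card_one_eq[OF assms(5)])
    thus False using A by simp
  qed
  moreover have "edges H \<union> [C]\<^bsup>2\<^esup> = (\<Union>X\<in>insert C A. [X]\<^bsup>2\<^esup>) \<union> [B]\<^bsup>2\<^esup> \<union> [D]\<^bsup>2\<^esup>"
    using A(11) by auto
  moreover have "\<Union>(insert C A) \<union> B \<union> D = verts H \<union> C" using A(10) by auto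
  moreover have "finite (insert C A)" "card (insert C A) = Suc q"
    "\<forall>X\<in>insert C A. finite X \<and> card X = k" "B \<union> D \<notin> insert C A"
    using A(1-3,9) C assms(2,3) by auto
  ultimately show ?thesis
    unfolding doubled_clique_tree_def graph_union_def complete_on_def fst_conv snd_conv
      insert_commute[of C]
    using A(4-8)
    by - (rule exI[of _ "insert C A"], rule exI[of _ B], rule exI[of _ D], intro conjI)
qed

text \<open>The old part of \<open>C\<close> is a clique of \<open>H\<close>, so it lies in a single
  hyperedge \<open>B\<close>. Merging \<open>B\<close> and \<open>C\<close> into one hyperedge adds
  only new vertices to \<open>B\<close> and closes no cycle by \<open>has_cycle_extendD\<close>.
  Since \<open>B\<close> leaves the ordinary cliques, \<open>Suc q\<close> becomes
  \<open>q\<close>.\<close>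

lemma clique_tree_attach_clique:
  assumes "clique_tree k (Suc q) H" "finite C" "card C = k" "\<not> C \<subseteq> verts H"
    and meet: "C \<inter> verts H \<noteq> {}" and old: "[C \<inter> verts H]\<^bsup>2\<^esup> \<subseteq> edges H"
  shows "doubled_clique_tree k q (card (C \<inter> verts H)) (graph_union H (complete_on C))"
proof -
  obtain A where A: "finite A" "card A = Suc q" "\<forall>B\<in>A. finite B \<and> card B = k"
    "\<Union>A = verts H" "edges H = (\<Union>B\<in>A. [B]\<^bsup>2\<^esup>)" "\<not> has_cycle (verts H, A)"
    using assms(1) unfolding clique_tree_def by auto
  obtain B where B: "B \<in> A" "C \<inter> verts H \<subseteq> B"
    using acyclic_clique_in_hyperedge[OF A(6) meet] A(4,5) old by auto
  have BH: "B \<subseteq> verts H" using B A(4) by auto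
  hence BC: "B \<inter> C = C \<inter> verts H" using B(2) by auto
  define A' where "A' = A - {B}"
  have iA: "insert B A' = A" using B by (auto simp: A'_def)
  have "\<not> has_cycle (verts H \<union> C, insert (B \<union> C) A')"
  proof
    assume "has_cycle (verts H \<union> C, insert (B \<union> C) A')"
    hence "has_cycle (verts H, insert B A')"
    proof (rule has_cycle_extendD)
      show "B \<notin> A'" by (simp add: A'_def)
      show "(C - B) \<inter> \<Union>A' = {}" using A(4) B(2) by (auto simp: A'_def)
    qed
    thus False using A iA by simp
  qed
  moreover have "B \<union> C \<notin> A'" using A(4) assms(4) by (auto simp: A'_def)
  moreover have "card A' = q" "finite A'" using A B by (auto simp: A'_def)
  moreover have "\<Union>A' \<union> B \<union> C = verts H \<union> C"
    using A(4) unfolding iA[symmetric] by auto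
  moreover have "(\<Union>X\<in>A'. [X]\<^bsup>2\<^esup>) \<union> [B]\<^bsup>2\<^esup> \<union> [C]\<^bsup>2\<^esup> = edges H \<union> [C]\<^bsup>2\<^esup>"
    using A(5) unfolding iA[symmetric] by auto
  moreover have "\<forall>X\<in>A'. finite X \<and> card X = k" using A by (auto simp: A'_def)
  ultimately show ?thesis
    unfolding doubled_clique_tree_def graph_union_def complete_on_def
    using A(3) B(1) assms(2,3) BC
    by - (rule exI[of _ A'], rule exI[of _ B], rule exI[of _ C], simp)
qed

section \<open>From clique trees to members of \<open>G_tree\<close>\<close>

lemma doubled_clique_tree_in_G_tree:
  assumes D: "doubled_clique_tree k q s G" and G: "simple_graph G" "connected_hypergraph G"
    and k: "0 < k"
  shows "G \<in> G_tree (replicate q (K k) @ [two_cliques k s])"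
proof -
  obtain A B C where A: "finite A" "card A = q" "\<forall>X\<in>A. finite X \<and> card X = k"
    "finite B" "finite C" "card B = k" "card C = k" "card (B \<inter> C) = s" "B \<union> C \<notin> A"
    "\<Union>A \<union> B \<union> C = verts G" "edges G = (\<Union>X\<in>A. [X]\<^bsup>2\<^esup>) \<union> [B]\<^bsup>2\<^esup> \<union> [C]\<^bsup>2\<^esup>"
    "\<not> has_cycle (verts G, insert (B \<union> C) A)"
    using D unfolding doubled_clique_tree_def by auto
  let ?Fs = "replicate q (K k) @ [two_cliques k s]"
  let ?A = "insert (B \<union> C) A"
  obtain h where h: "bij_betw h {..<q} A"
    using ex_bij_betw_nat_finite[OF A(1)] A(2) by (auto simp: atLeast0LessThan)
  \<comment> \<open>The doubled hyperedge gets the last index \<open>q\<close>, matching the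
    position of \<open>two_cliques k s\<close> in the list.\<close>
  define E where "E i = (if i < q then h i else B \<union> C)" for i
  have EA: "E i \<in> A" if "i < q" for i
    using that h by (auto simp: E_def bij_betw_def)
  have img: "E ` {..<q} = A"
    using h by (auto simp: E_def bij_betw_def)
  have Eimg: "E ` {..<length ?Fs} = ?A"
    unfolding img[symmetric] by (simp add: lessThan_Suc) (simp add: E_def)
  have Einj: "inj_on E {..<length ?Fs}"
  proof -
    have "inj_on E {..<q}" using h by (auto simp: E_def bij_betw_def inj_on_def)
    moreover have "E q \<notin> E ` {..<q}" unfolding img using A(9) by (simp add: E_def)
    ultimately show ?thesis by (simp add: lessThan_Suc)
  qed
  have cover: "\<exists>X\<in>?A. e \<subseteq> X" if "e \<in> edges G" for e
    using that unfolding A(11) by (auto simp: nsets_def)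
  have "connected_hypergraph (verts G, ?A)"
  proof -
    have "{(x, y). \<exists>e\<in>edges G. x \<in> e \<and> y \<in> e} \<subseteq> {(x, y). \<exists>e\<in>?A. x \<in> e \<and> y \<in> e}"
    proof clarify
      fix x y e assume e: "e \<in> edges G" "x \<in> e" "y \<in> e"
      obtain X where "X \<in> ?A" "e \<subseteq> X" using cover[OF e(1)] by blast
      thus "\<exists>e\<in>?A. x \<in> e \<and> y \<in> e" using e by blast
    qed
    from rtrancl_mono[OF this] show ?thesis
      using G(2) unfolding connected_hypergraph_def by auto
  qed
  moreover have "hypergraph (verts G, ?A)"
    using G(1) A k by (auto simp: hypergraph_def simple_graph_def)
  ultimately have tree: "hypertree (verts G, ?A)"
    using A(12) by (simp add: hypertree_def)
  have lin: "linear_hypergraph (verts G, ?A)"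
    by (rule acyclic_linear[OF A(12)])
  have "induced_subgraph G (E i) \<simeq>\<^sub>g ?Fs ! i" if i: "i < length ?Fs" for i
  proof (cases "i < q")
    case True
    hence "induced_subgraph G (E i) = complete_on (E i)"
      using EA[OF True] A(11) G(1)
      by (auto simp: induced_subgraph_def complete_on_def nsets_def)
    thus ?thesis
      using True EA[OF True] A(3) complete_on_iso_K[of "E i" k] by (simp add: nth_append)
  next
    case False
    \<comment> \<open>No other clique contributes an edge inside \<open>B \<union> C\<close>: it
      would share two vertices with this hyperedge and so equal it, against
      \<open>B \<union> C \<notin> A\<close>.\<close>
    have "e \<in> [B]\<^bsup>2\<^esup> \<union> [C]\<^bsup>2\<^esup>" if e: "e \<in> edges G" "e \<subseteq> B \<union> C" for e
    proof (rule ccontr)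
      assume "e \<notin> [B]\<^bsup>2\<^esup> \<union> [C]\<^bsup>2\<^esup>"
      then obtain X where X: "X \<in> A" "e \<in> [X]\<^bsup>2\<^esup>" using e A(11) by auto
      then obtain x y where "x \<noteq> y" "e = {x, y}" "e \<subseteq> X"
        by (auto simp: nsets_def card_2_iff)
      hence "X = B \<union> C"
        using acyclic_share_two_eq[OF A(12), of X "B \<union> C" x y] X e by auto
      thus False using X A by auto
    qed
    moreover have "[B]\<^bsup>2\<^esup> \<union> [C]\<^bsup>2\<^esup> \<subseteq> edges G" unfolding A(11) by blast
    moreover have "e \<subseteq> B \<union> C" if "e \<in> [B]\<^bsup>2\<^esup> \<union> [C]\<^bsup>2\<^esup>" for e
      using that by (auto simp: nsets_def)
    ultimately have "{e \<in> edges G. e \<subseteq> B \<union> C} = [B]\<^bsup>2\<^esup> \<union> [C]\<^bsup>2\<^esup>" by blast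
    hence "induced_subgraph G (B \<union> C) = graph_union (complete_on B) (complete_on C)"
      by (simp add: induced_subgraph_def graph_union_def complete_on_def)
    moreover have "i = q" using False i by simp
    ultimately show ?thesis
      using union_iso_two_cliques[OF A(4-8)] by (simp add: E_def nth_append)
  qed
  moreover have "\<exists>i<length ?Fs. u \<in> E i \<and> v \<in> E i" if uv: "{u, v} \<in> edges G" for u v
  proof -
    obtain X where "X \<in> ?A" "{u, v} \<subseteq> X" using cover[OF uv] by auto
    thus ?thesis unfolding Eimg[symmetric] by auto
  qed
  ultimately show ?thesis
    unfolding G_tree_def mem_Collect_eq Eimg[symmetric]
    using G(1) Einj lin tree unfolding Eimg[symmetric]
    by (intro conjI exI[of _ E] allI impI)
qed

subsection \<open>Counting edges of a tree of graphs\<close>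

text \<open>The hyperedges partition the edges of \<open>G\<close>: every edge lies in some
  hyperedge, and by linearity in only one.\<close>

lemma G_tree_card_edges:
  assumes "G \<in> G_tree Fs"
  shows "card (edges G) = (\<Sum>i<length Fs. card (edges (Fs ! i)))"
proof -
  obtain E where G: "simple_graph G" and E: "inj_on E {..<length Fs}"
    "linear_hypergraph (verts G, E ` {..<length Fs})"
    "hypertree (verts G, E ` {..<length Fs})"
    "\<And>u v. {u, v} \<in> edges G \<Longrightarrow> \<exists>i<length Fs. u \<in> E i \<and> v \<in> E i"
    "\<And>i. i < length Fs \<Longrightarrow> induced_subgraph G (E i) \<simeq>\<^sub>g Fs ! i"
    using assms unfolding G_tree_def by auto
  let ?P = "\<lambda>i. {e \<in> edges G. e \<subseteq> E i}"
  have fin: "finite (edges G)"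
    using G finite_imp_finite_nsets[of "verts G" 2] finite_subset
    by (auto simp: simple_graph_def)
  have e2: "finite e \<and> card e = 2" if "e \<in> edges G" for e
    using G that by (auto simp: simple_graph_def nsets_def)
  have "edges G = (\<Union>i<length Fs. ?P i)"
  proof -
    have "\<exists>i<length Fs. e \<subseteq> E i" if e: "e \<in> edges G" for e
    proof -
      obtain u v where "e = {u, v}" using e2[OF e] by (auto simp: card_2_iff)
      thus ?thesis using E(4)[of u v] e by auto
    qed
    thus ?thesis by blast
  qed
  also have "card \<dots> = (\<Sum>i<length Fs. card (?P i))"
  proof (rule card_UN_disjoint)
    show "\<forall>i\<in>{..<length Fs}. \<forall>j\<in>{..<length Fs}. i \<noteq> j \<longrightarrow> ?P i \<inter> ?P j = {}"
    proof (intro ballI impI, rule ccontr)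
      fix i j assume ij: "i \<in> {..<length Fs}" "j \<in> {..<length Fs}" "i \<noteq> j"
        and "?P i \<inter> ?P j \<noteq> {}"
      then obtain e where e: "e \<in> edges G" "e \<subseteq> E i \<inter> E j" by auto
      have "finite (E i)"
        using E(3) ij finite_subset by (auto simp: hypertree_def hypergraph_def)
      hence "2 \<le> card (E i \<inter> E j)"
        using e2[OF e(1)] card_mono[of "E i \<inter> E j" e] e by auto
      moreover have "E i \<noteq> E j" using E(1) ij by (auto simp: inj_on_def)
      ultimately show False using E(2) ij by (force simp: linear_hypergraph_def)
    qed
  qed (use fin in auto)
  also have "\<dots> = (\<Sum>i<length Fs. card (edges (Fs ! i)))"
  proof (rule sum.cong)
    fix i assume "i \<in> {..<length Fs}"
    thus "card (?P i) = card (edges (Fs ! i))"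
      using graph_iso_card_edges[OF E(5)[of i]] by (auto simp: induced_subgraph_def)
  qed simp
  finally show ?thesis .
qed

subsection \<open>Attaching cliques one at a time\<close>

text \<open>The bound is twice the minimal edge count: \<open>q + 1\<close> full cliques and
  \<open>2 * g(r)\<close> for the remainder. Here \<open>r\<close> runs from 0 to
  \<open>k - 2\<close>, so the remainder \<open>k - 1\<close> of the theorem appears as
  \<open>r = 0\<close> with \<open>q\<close> one larger. For \<open>r = 0\<close> two shapes are
  kept: the clique tree, to continue growing, and the doubled tree with \<open>s = 1\<close>, for
  the final answer.\<close>

definition extremal_state :: "nat \<Rightarrow> nat \<Rightarrow> nat \<Rightarrow> 'a graph \<Rightarrow> bool" where
  "extremal_state k q r H \<longleftrightarrow> r < k - 1 \<and> card (verts H) = k + q * (k - 1) + r \<and>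
     (q + 1) * (k * (k - 1)) + r * (2 * k - 1 - r) \<le> 2 * card (edges H) \<and>
     (2 * card (edges H) = (q + 1) * (k * (k - 1)) + r * (2 * k - 1 - r) \<longrightarrow>
       (r = 0 \<longrightarrow> clique_tree k (q + 1) H \<and> (\<forall>q'. q = Suc q' \<longrightarrow> doubled_clique_tree k q' 1 H)) \<and>
       (0 < r \<longrightarrow> doubled_clique_tree k q (k - r) H))"

text \<open>The two cases of strict concavity: \<open>r + t\<close> stays below \<open>k - 1\<close>, or wraps around.\<close>

lemma gain_add:
  fixes k r t :: nat
  assumes "r + t \<le> k - 1"
  shows "r * (2 * k - 1 - r) + t * (2 * k - 1 - t) = (r + t) * (2 * k - 1 - (r + t)) + 2 * (r * t)"
proof -
  \<comment> \<open>The slack \<open>d\<close> removes the subtractions; for \<open>k = 0\<close>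
    the truncated \<open>2 * k - 1\<close> is 0, hence the case distinction.\<close>
  obtain d where "k - 1 = r + t + d" using assms le_Suc_ex by blast
  hence "2 * k - 1 - r = r + 2 * t + 2 * d + (if k = 0 then 0 else 1)"
    "2 * k - 1 - t = 2 * r + t + 2 * d + (if k = 0 then 0 else 1)"
    "2 * k - 1 - (r + t) = r + t + 2 * d + (if k = 0 then 0 else 1)" by auto
  thus ?thesis by (auto simp: algebra_simps)
qed

lemma gain_wrap:
  fixes k r t u :: nat
  assumes "r \<le> k - 1" "t \<le> k - 1" "r + t = (k - 1) + u" "0 < k"
  shows "r * (2 * k - 1 - r) + t * (2 * k - 1 - t)
    = k * (k - 1) + u * (2 * k - 1 - u) + 2 * ((k - 1 - r) * (k - 1 - t))"
proof -
  \<comment> \<open>With \<open>a = k - 1 - r\<close> and \<open>b = k - 1 - t\<close>, both sides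
    become polynomials in \<open>u\<close>, \<open>a\<close>, \<open>b\<close>.\<close>
  obtain a where a: "k - 1 = r + a" using assms le_Suc_ex by blast
  hence t: "t = u + a" using assms by simp
  then obtain b where b: "k - 1 = u + a + b" using assms le_Suc_ex by blast
  hence r: "r = u + b" using a by simp
  have k: "k = Suc (u + a + b)" using b assms by simp
  have "2 * k - 1 - r = u + 2 * a + b + 1" "2 * k - 1 - t = u + a + 2 * b + 1"
    "2 * k - 1 - u = u + 2 * a + 2 * b + 1" "k - 1 - r = a" "k - 1 - t = b"
    unfolding k r t by auto
  thus ?thesis unfolding k r t by (simp add: algebra_simps)
qed

text \<open>The number \<open>t\<close> of new vertices is added to the remainder modulo
  \<open>k - 1\<close>. A full step \<open>t = k - 1\<close> keeps \<open>r\<close>; a smaller step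
  either stays below \<open>k - 1\<close>, with surplus proportional to \<open>r * t\<close>, or
  wraps around with a strict surplus.\<close>

lemma extremal_state_attach:
  assumes k: "3 \<le> k" and st: "extremal_state k q r H" and H: "simple_graph H"
    and C: "finite C" "card C = k" "C \<inter> verts H \<noteq> {}" "\<not> C \<subseteq> verts H"
  shows "\<exists>q' r'. extremal_state k q' r' (graph_union H (complete_on C))"
proof -
  let ?H = "graph_union H (complete_on C)"
  define t where "t = card (C - verts H)"
  have finH: "finite (verts H)" "edges H \<subseteq> [verts H]\<^bsup>2\<^esup>"
    using H by (auto simp: simple_graph_def)
  hence fE: "finite (edges H)" using finite_imp_finite_nsets finite_subset by blast
  have "card C = card (C \<inter> verts H) + t"
    unfolding t_def using card_Int_Diff[OF C(1)] by simp
  moreover have "0 < card (C \<inter> verts H)" "0 < t"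
    using C by (auto simp: t_def card_gt_0_iff)
  ultimately have t: "1 \<le> t" "t \<le> k - 1" and ct: "card (C \<inter> verts H) = k - t"
    using C(2) by auto
  have cV: "card (verts ?H) = card (verts H) + t"
    using card_Un_disjoint[of "verts H" "C - verts H"] finH C(1)
    by (simp add: graph_union_def complete_on_def t_def)
  have f2: "finite ([C]\<^bsup>2\<^esup>)" "finite ([C \<inter> verts H]\<^bsup>2\<^esup>)"
    using C(1) by (auto simp: finite_imp_finite_nsets)
  have sub: "[C]\<^bsup>2\<^esup> \<inter> edges H \<subseteq> [C \<inter> verts H]\<^bsup>2\<^esup>"
    using finH(2) nsets_inter[of C 2 "verts H"] by blast
  \<comment> \<open>\<open>w\<close> counts the edges of \<open>C\<close> already present; it is
    maximal exactly when the old part of \<open>C\<close> is a clique of \<open>H\<close>.\<close>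
  define w where "w = card ([C]\<^bsup>2\<^esup> \<inter> edges H)"
  have wle: "w \<le> (k - t) choose 2"
    unfolding w_def using card_mono[OF f2(2) sub] ct by simp
  have weq: "[C \<inter> verts H]\<^bsup>2\<^esup> \<subseteq> edges H" if "w = (k - t) choose 2"
    using card_subset_eq[OF f2(2) sub] that ct by (auto simp: w_def)
  have cE: "card (edges ?H) + w = card (edges H) + (k choose 2)"
    using card_Un_Int[OF f2(1) fE] C(2)
    by (simp add: w_def graph_union_def complete_on_def Un_commute)
  \<comment> \<open>This identifies \<open>t * (2 * k - 1 - t)\<close> as twice the guaranteed gain
    \<open>g(t)\<close>.\<close>
  have gt: "k * (k - 1) = 2 * ((k - t) choose 2) + t * (2 * k - 1 - t)"
  proof -
    obtain b where b: "k - 1 = t + b" using t le_Suc_ex by blast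
    have kk: "k = Suc (t + b)" using b k by simp
    have "2 * k - 1 - t = t + 2 * b + 1" "k - t = Suc b" unfolding kk by auto
    thus ?thesis unfolding two_times_choose_two kk by (simp add: algebra_simps)
  qed
  have step: "2 * card (edges ?H) + 2 * w = 2 * card (edges H) + 2 * ((k - t) choose 2) + t * (2 * k - 1 - t)"
    using cE gt two_times_choose_two[of k] by simp
  have st': "r < k - 1" "card (verts H) = k + q * (k - 1) + r"
    "(q + 1) * (k * (k - 1)) + r * (2 * k - 1 - r) \<le> 2 * card (edges H)"
    and shape: "2 * card (edges H) = (q + 1) * (k * (k - 1)) + r * (2 * k - 1 - r) \<Longrightarrow>
       (r = 0 \<longrightarrow> clique_tree k (q + 1) H \<and> (\<forall>q'. q = Suc q' \<longrightarrow> doubled_clique_tree k q' 1 H)) \<and>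
       (0 < r \<longrightarrow> doubled_clique_tree k q (k - r) H)"
    using st unfolding extremal_state_def by auto
  show ?thesis
  proof (cases "t = k - 1")
    case True
    have tt: "t * (2 * k - 1 - t) = k * (k - 1)" unfolding True using k by simp
    have t1: "k - t = 1" using True k by simp
    hence c1: "card (C \<inter> verts H) = 1" using ct by simp
    have d: "(q + 1 + 1) * (k * (k - 1)) = (q + 1) * (k * (k - 1)) + k * (k - 1)"
      by (simp only: add_mult_distrib mult_1)
    have "extremal_state k (q + 1) r ?H"
      unfolding extremal_state_def
    proof (intro conjI impI)
      show "r < k - 1" by fact
      show "card (verts ?H) = k + (q + 1) * (k - 1) + r"
        unfolding cV st'(2) True add_mult_distrib mult_1 by (simp only: ac_simps)
      show "(q + 1 + 1) * (k * (k - 1)) + r * (2 * k - 1 - r) \<le> 2 * card (edges ?H)"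
        using step st'(3) wle tt unfolding d by linarith
      assume eq: "2 * card (edges ?H) = (q + 1 + 1) * (k * (k - 1)) + r * (2 * k - 1 - r)"
      \<comment> \<open>The new bound is the sum of the bound for \<open>H\<close> and the bound on
        \<open>w\<close>, so equality makes both tight.\<close>
      have old: "2 * card (edges H) = (q + 1) * (k * (k - 1)) + r * (2 * k - 1 - r)"
        using eq step st'(3) wle tt unfolding d by linarith
      have "w = (k - t) choose 2" using eq step st'(3) wle tt unfolding d by linarith
      note w = weq[OF this]
      {
        assume "r = 0"
        hence T: "clique_tree k (q + 1) H" using shape[OF old] by simp
        show "clique_tree k (q + 1 + 1) ?H"
          using clique_tree_attach_leaf[OF T C(1,2,4) c1] by simp
        \<comment> \<open>The leaf \<open>C\<close> can also be merged with an old clique through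
          its attachment vertex, giving a doubled hyperedge with \<open>s = 1\<close>.\<close>
        show "\<forall>q'. q + 1 = Suc q' \<longrightarrow> doubled_clique_tree k q' 1 ?H"
          using clique_tree_attach_clique[of k q H C] T C w c1 by simp
      next
        assume "0 < r"
        hence T: "doubled_clique_tree k q (k - r) H" using shape[OF old] by simp
        show "doubled_clique_tree k (q + 1) (k - r) ?H"
          using doubled_clique_tree_attach_leaf[OF T C(1,2,4) c1] by simp
      }
    qed
    thus ?thesis by blast
  next
    case False
    hence tlt: "t < k - 1" using t by simp
    show ?thesis
    proof (cases "r + t < k - 1")
      case small: True
      have g: "r * (2 * k - 1 - r) + t * (2 * k - 1 - t)
          = (r + t) * (2 * k - 1 - (r + t)) + 2 * (r * t)"
        by (rule gain_add) (use small in simp)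
      have "extremal_state k q (r + t) ?H"
        unfolding extremal_state_def
      proof (intro conjI impI)
        show "r + t < k - 1" by fact
        show "card (verts ?H) = k + q * (k - 1) + (r + t)" using cV st' by simp
        show "(q + 1) * (k * (k - 1)) + (r + t) * (2 * k - 1 - (r + t)) \<le> 2 * card (edges ?H)"
          using step st'(3) wle g by linarith
        assume eq: "2 * card (edges ?H) = (q + 1) * (k * (k - 1)) + (r + t) * (2 * k - 1 - (r + t))"
        \<comment> \<open>Equality also removes the surplus \<open>2 * (r * t)\<close>; as
          \<open>1 \<le> t\<close>, this leaves \<open>r = 0\<close>, so \<open>H\<close> is still a
          clique tree when \<open>C\<close> creates the doubled hyperedge.\<close>
        have "r * t = 0" using eq step st'(3) wle g by linarith
        hence r0: "r = 0" using t by simp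
        have old: "2 * card (edges H) = (q + 1) * (k * (k - 1)) + r * (2 * k - 1 - r)"
          using eq step st'(3) wle g by linarith
        have "w = (k - t) choose 2" using eq step st'(3) wle g by linarith
        note w = weq[OF this]
        have T: "clique_tree k (q + 1) H" using shape[OF old] r0 by simp
        show "doubled_clique_tree k q (k - (r + t)) ?H"
          using clique_tree_attach_clique[of k q H C] T C w ct r0 by simp
        assume "r + t = 0"
        thus "clique_tree k (q + 1) ?H" "\<forall>q'. q = Suc q' \<longrightarrow> doubled_clique_tree k q' 1 ?H"
          using t by auto
      qed
      thus ?thesis by blast
    next
      case False
      then obtain u where u: "r + t = (k - 1) + u" using le_Suc_ex not_less by blast
      have g: "r * (2 * k - 1 - r) + t * (2 * k - 1 - t)
          = k * (k - 1) + u * (2 * k - 1 - u) + 2 * ((k - 1 - r) * (k - 1 - t))"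
        by (rule gain_wrap) (use u st' tlt k in auto)
      \<comment> \<open>Both \<open>r\<close> and \<open>t\<close> are below \<open>k - 1\<close>,
        so the wrap-around is strictly wasteful and the equality clause of the new state is
        vacuous.\<close>
      have pos: "0 < (k - 1 - r) * (k - 1 - t)" using st'(1) tlt by (intro mult_pos_pos) linarith+
      have d: "(q + 1 + 1) * (k * (k - 1)) = (q + 1) * (k * (k - 1)) + k * (k - 1)"
        by (simp only: add_mult_distrib mult_1)
      have lt: "(q + 1 + 1) * (k * (k - 1)) + u * (2 * k - 1 - u) < 2 * card (edges ?H)"
        using step st'(3) wle g pos unfolding d by linarith
      have "extremal_state k (q + 1) u ?H"
        unfolding extremal_state_def
        using lt cV st' u tlt by auto
      thus ?thesis by blast
    qed
  qed
qed

section \<open>Growing a spanning subgraph of \<open>G\<close>\<close>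

text \<open>A subgraph isomorphic to \<open>K k\<close> contains every pair of its vertices as an
  edge, by pulling pairs back along the isomorphism; its vertex set is the required
  \<open>C\<close>.\<close>

lemma has_coverD:
  assumes "has_cover k 1 G" "e \<in> edges G"
  obtains C where "C \<subseteq> verts G" "card C = k" "[C]\<^bsup>2\<^esup> \<subseteq> edges G" "e \<subseteq> C"
proof -
  have "1 \<le> card {H \<in> copies (K k) G. e \<in> edges H}"
    using assms unfolding has_cover_def by blast
  hence "{H \<in> copies (K k) G. e \<in> edges H} \<noteq> {}" by (metis card.empty not_one_le_zero)
  then obtain H where H: "subgraph H G" "H \<simeq>\<^sub>g K k" "e \<in> edges H"
    by (auto simp: copies_def)
  obtain f where f: "bij_betw f (verts H) {..<k}"
    and fe: "[{..<k}]\<^bsup>2\<^esup> = (\<lambda>e. f ` e) ` edges H"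
    using H(2) by (auto simp: graph_iso_def complete_on_def)
  have sH: "edges H \<subseteq> [verts H]\<^bsup>2\<^esup>" using H(1) by (simp add: subgraph_def simple_graph_def)
  have inj: "inj_on f (verts H)" "f ` verts H = {..<k}" using f by (auto simp: bij_betw_def)
  have "[verts H]\<^bsup>2\<^esup> \<subseteq> edges H"
  proof
    fix x assume x: "x \<in> [verts H]\<^bsup>2\<^esup>"
    hence "f ` x \<in> (\<lambda>e. f ` e) ` edges H"
      unfolding fe[symmetric] inj(2)[symmetric] image_nsets[OF inj(1), symmetric] by blast
    then obtain y where y: "y \<in> edges H" "f ` x = f ` y" by auto
    hence "x = y"
      using x sH inj_on_image_eq_iff[OF inj(1), of x y] by (auto simp: nsets_def)
    thus "x \<in> edges H" using y by simp
  qed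
  moreover have "card (verts H) = k" using bij_betw_same_card[OF f] by simp
  moreover have "e \<subseteq> verts H" using H(3) sH by (auto simp: nsets_def)
  ultimately show thesis using that[of "verts H"] H(1) by (auto simp: subgraph_def)
qed

text \<open>Some step of a walk from a vertex of \<open>S\<close> to a vertex outside must leave
  \<open>S\<close>.\<close>

lemma connected_crossing_edge:
  assumes "connected_hypergraph G" "S \<subseteq> verts G" "S \<noteq> {}" "S \<noteq> verts G"
  obtains e where "e \<in> edges G" "e \<inter> S \<noteq> {}" "\<not> e \<subseteq> S"
proof -
  let ?R = "{(x, y). \<exists>e\<in>edges G. x \<in> e \<and> y \<in> e}"
  obtain u v where uv: "u \<in> S" "v \<in> verts G" "v \<notin> S" using assms by auto
  have "(u, v) \<in> ?R\<^sup>*" using assms uv by (auto simp: connected_hypergraph_def)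
  hence "v \<notin> S \<Longrightarrow> \<exists>e\<in>edges G. e \<inter> S \<noteq> {} \<and> \<not> e \<subseteq> S"
    by (induction rule: rtrancl_induct) (use uv in blast)+
  thus thesis using uv that by blast
qed

text \<open>While vertices are missing, an edge leaving \<open>H\<close> lies in a
  \<open>k\<close>-clique of \<open>G\<close>, which meets \<open>H\<close> and brings new vertices.
  The induction is on the number of missing vertices.\<close>

lemma spanning_extremal_state:
  assumes k: "3 \<le> k" and G: "simple_graph G" "connected_hypergraph G" "has_cover k 1 G"
    and n: "1 < card (verts G)"
  obtains q r H where "extremal_state k q r H" "verts H = verts G" "edges H \<subseteq> edges G"
proof -
  have fG: "finite (verts G)" using G(1) by (simp add: simple_graph_def)
  have grow: "\<exists>q r H'. extremal_state k q r H' \<and> verts H' = verts G \<and> edges H' \<subseteq> edges G"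
    if "extremal_state k q r H" "simple_graph H" "verts H \<subseteq> verts G" "edges H \<subseteq> edges G"
    for q r and H :: "'a graph"
    using that
  proof (induction "card (verts G - verts H)" arbitrary: q r H rule: less_induct)
    case less
    show ?case
    proof (cases "verts H = verts G")
      case False
      have "verts H \<noteq> {}" using less.prems(1) k by (auto simp: extremal_state_def)
      then obtain e where e: "e \<in> edges G" "e \<inter> verts H \<noteq> {}" "\<not> e \<subseteq> verts H"
        using connected_crossing_edge[OF G(2) less.prems(3)] False by blast
      obtain C where C: "C \<subseteq> verts G" "card C = k" "[C]\<^bsup>2\<^esup> \<subseteq> edges G" "e \<subseteq> C"
        using has_coverD[OF G(3) e(1)] by blast
      have fC: "finite C" using C(1) fG finite_subset by blast
      let ?H = "graph_union H (complete_on C)"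
      obtain q' r' where "extremal_state k q' r' ?H"
        using extremal_state_attach[OF k less.prems(1,2) fC C(2)] e C(4) by blast
      moreover have "simple_graph ?H"
        using less.prems(2) fC nsets_mono[of "verts H" "verts H \<union> C" 2] nsets_mono[of C "verts H \<union> C" 2]
        by (auto simp: simple_graph_def graph_union_def complete_on_def)
      moreover have "verts ?H \<subseteq> verts G" "edges ?H \<subseteq> edges G"
        using less.prems(3,4) C by (auto simp: graph_union_def complete_on_def)
      moreover have "card (verts G - verts ?H) < card (verts G - verts H)"
        using e C fG by (intro psubset_card_mono) (auto simp: graph_union_def complete_on_def)
      ultimately show ?thesis using less.hyps by blast
    qed (use less.prems in blast)
  qed
  obtain v where v: "v \<in> verts G" using n by (metis card.empty all_not_in_conv not_less_zero)
  \<comment> \<open>An edge leaving the single vertex \<open>v\<close> supplies the starting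
    clique.\<close>
  obtain e where e: "e \<in> edges G"
  proof (rule connected_crossing_edge[OF G(2), of "{v}"])
    show "{v} \<noteq> verts G" using n by (metis card_1_singleton_iff less_irrefl One_nat_def)
  qed (use v in auto)
  obtain C where C: "C \<subseteq> verts G" "card C = k" "[C]\<^bsup>2\<^esup> \<subseteq> edges G"
    using has_coverD[OF G(3) e] by blast
  have fC: "finite C" using C(1) fG finite_subset by blast
  have "extremal_state k 0 0 (complete_on C)"
    unfolding extremal_state_def
    using clique_tree_single[OF fC C(2)] C(2) k fC two_times_choose_two[of k]
    by (simp add: complete_on_def)
  moreover have "simple_graph (complete_on C)" using fC by (simp add: simple_graph_def complete_on_def)
  ultimately have "\<exists>q r H'. extremal_state k q r H' \<and> verts H' = verts G \<and> edges H' \<subseteq> edges G"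
    using C by (intro grow) (auto simp: complete_on_def)
  thus thesis using that by blast
qed

section \<open>The edge bound and its equality case\<close>

lemma quotient_remainder_unique:
  fixes a b c a' b' :: nat
  assumes eq: "a * c + b = a' * c + b'" and "b < c" "b' < c"
  shows "a = a' \<and> b = b'"
  using assms(2,3) arg_cong[OF eq, of "\<lambda>x. x div c"] arg_cong[OF eq, of "\<lambda>x. x mod c"] by simp

text \<open>This translates remainders from 0 to \<open>k - 2\<close> into remainders from 1 to
  \<open>k - 1\<close>; only \<open>r = k - 1\<close> changes the quotient.\<close>

lemma extremal_state_bound:
  assumes k: "3 \<le> k" and st: "extremal_state k q0 r0 H"
    and card: "card (verts H) = k + q * (k - 1) + r" and r: "1 \<le> r" "r \<le> k - 1"
  shows "(q + 2) * (k choose 2) \<le> card (edges H) + ((k - r) choose 2)"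
    and "card (edges H) + ((k - r) choose 2) = (q + 2) * (k choose 2) \<Longrightarrow>
      doubled_clique_tree k q (k - r) H"
proof -
  have k2: "k * (k - 1) = 2 * (k choose 2)" by (simp add: two_times_choose_two)
  have st': "r0 < k - 1" "card (verts H) = k + q0 * (k - 1) + r0"
    using st by (auto simp: extremal_state_def)
  have *: "(q + 2) * (k choose 2) \<le> card (edges H) + ((k - r) choose 2) \<and>
    (card (edges H) + ((k - r) choose 2) = (q + 2) * (k choose 2) \<longrightarrow>
      doubled_clique_tree k q (k - r) H)"
  proof (cases "r = k - 1")
    case True
    \<comment> \<open>The state is \<open>q + 1\<close> with remainder 0; its doubled shape with
      \<open>s = 1\<close> is the required one, because \<open>k - r = 1\<close>.\<close>
    have "q * (k - 1) + (k - 1) = q0 * (k - 1) + r0" using card st'(2) unfolding True by linarith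
    hence "(q + 1) * (k - 1) + 0 = q0 * (k - 1) + r0" unfolding add_mult_distrib by simp
    hence "q0 = q + 1 \<and> r0 = 0"
      using quotient_remainder_unique[of "q + 1" "k - 1" 0 q0 r0] st'(1) by linarith
    moreover have "k - r = 1" using True k by simp
    ultimately show ?thesis
      using st unfolding extremal_state_def k2 by (auto simp: algebra_simps)
  next
    case False
    hence rl: "r < k - 1" using r by simp
    have "q * (k - 1) + r = q0 * (k - 1) + r0" using card st' by simp
    hence qr: "q0 = q" "r0 = r"
      using quotient_remainder_unique[of q "k - 1" r q0 r0] st'(1) rl by linarith+
    have g: "2 * ((k - r) choose 2) + r * (2 * k - 1 - r) = 2 * (k choose 2)"
    proof -
      obtain b where b: "k - 1 = r + b" using r le_Suc_ex by blast
      have kk: "k = Suc (r + b)" using b k by simp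
      have "2 * k - 1 - r = r + 2 * b + 1" "k - r = Suc b" unfolding kk by auto
      thus ?thesis unfolding two_times_choose_two kk by (simp add: algebra_simps)
    qed
    show ?thesis
      using st g r(1) unfolding extremal_state_def k2 qr by (auto simp: algebra_simps)
  qed
  show "(q + 2) * (k choose 2) \<le> card (edges H) + ((k - r) choose 2)" using * by blast
  show "card (edges H) + ((k - r) choose 2) = (q + 2) * (k choose 2) \<Longrightarrow>
      doubled_clique_tree k q (k - r) H" using * by blast
qed

theorem theorem1p4:
  fixes G :: "'a graph" and k n q r :: nat
  assumes "k \<ge> 3"
    and "simple_graph G"
    and "connected_hypergraph G"
    and "card (verts G) = n"
    and "has_cover k 1 G"
    and "int n - int k = int q * (int k - 1) + int r"
    and "1 \<le> r" and "r \<le> k - 1"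
  shows "int (card (edges G)) \<ge> (int q + 2) * int (k choose 2) - int ((k - r) choose 2) \<and>
    (int (card (edges G)) = (int q + 2) * int (k choose 2) - int ((k - r) choose 2) \<longleftrightarrow>
      G \<in> G_tree (replicate q (K k) @ [two_cliques k (k - r)]))"
proof -
  have "int n = int (k + q * (k - 1) + r)"
    using assms(1,6) by simp
  hence n: "card (verts G) = k + q * (k - 1) + r"
    using assms(4) by linarith
  obtain q0 r0 H where st: "extremal_state k q0 r0 H"
    and H: "verts H = verts G" "edges H \<subseteq> edges G"
    by (rule spanning_extremal_state[OF assms(1-3,5)]) (use n assms(1) in linarith)
  note bound = extremal_state_bound[OF assms(1) st, of q r, unfolded H(1), OF n assms(7,8)]
  have fin: "finite (edges G)"
    using assms(2) finite_imp_finite_nsets[of "verts G" 2] finite_subset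
    by (auto simp: simple_graph_def)
  have le: "card (edges H) \<le> card (edges G)" using card_mono[OF fin H(2)] .
  have ge: "(q + 2) * (k choose 2) \<le> card (edges G) + ((k - r) choose 2)"
    using bound(1) le by linarith
  have "card (edges G) + ((k - r) choose 2) = (q + 2) * (k choose 2) \<longleftrightarrow>
      G \<in> G_tree (replicate q (K k) @ [two_cliques k (k - r)])"
  proof
    assume eq: "card (edges G) + ((k - r) choose 2) = (q + 2) * (k choose 2)"
    \<comment> \<open>The spanning subgraph \<open>H\<close> already attains the bound, so equality
      for \<open>G\<close> leaves no further edges and \<open>H = G\<close> inherits the
      shape.\<close>
    hence "card (edges H) = card (edges G)" using bound(1) le by linarith
    hence "H = G" using card_subset_eq[OF fin H(2)] H(1) by (simp add: prod_eq_iff)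
    hence "doubled_clique_tree k q (k - r) G" using bound(2) eq by simp
    thus "G \<in> G_tree (replicate q (K k) @ [two_cliques k (k - r)])"
      by (rule doubled_clique_tree_in_G_tree[OF _ assms(2,3)]) (use assms(1) in linarith)
  next
    assume "G \<in> G_tree (replicate q (K k) @ [two_cliques k (k - r)])"
    \<comment> \<open>Conversely, membership alone determines the number of edges.\<close>
    hence "card (edges G) = q * (k choose 2) + card (edges (two_cliques k (k - r)))"
      by (simp add: G_tree_card_edges nth_append complete_on_def)
    thus "card (edges G) + ((k - r) choose 2) = (q + 2) * (k choose 2)"
      using two_cliques_card_edges[of "k - r" k] by simp
  qed
  moreover have "int ((q + 2) * (k choose 2)) = (int q + 2) * int (k choose 2)"
    by (simp add: algebra_simps)
  ultimately show ?thesis using ge by linarith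
qed

end
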